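(* Let $G=(V,E)$ be a simple undirected graph and $S\subseteq\binom{V}{2}$. Let $H\subseteq G$ be a connected subgraph sharing precisely two nodes $s,t$ with the rest of $G$, i.e., no edge in $E(G)\setminus E(H)$ is incident to a node in $V(H)\setminus\{s,t\}$, and assume no node of $V(H)\setminus\{s,t\}$ is a terminal. Let $a^{\mathsf T}x\geq b$ be facet-defining for $\mathrm{MultC}(G,S)$ and let $\omega$ be the weight of a minimum $s$-$t$-cut in $H$ with respect to the edge weights $a_e$, $e\in E(H)$. Obtain $\overline G=(\overline V,\overline E)$ from $G$ by replacing $H$ by the single edge $st$, and define $\bar a\in\mathbb{R}^{\overline E}$ by $\bar a_e=a_e$ for $e\neq st$ and $\bar a_{st}=\omega$. Then $\bar a^{\mathsf T}x\geq b$ is facet-defining for $\mathrm{MultC}(\overline G,S)$.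
   Context: Given a graph $G=(V,E)$ and $S\subseteq\binom{V}{2}$, an ($S$-)multicut is a set $\delta\subseteq E$ such that for every $\{s,t\}\in S$ the nodes $s$ and $t$ lie in different components of $G-\delta$. A node is a terminal if it belongs to some pair in $S$. For $F\subseteq E$, $x^F\in\mathbb{R}^E$ is its incidence vector. The multicut dominant is $\mathrm{MultC}(G,S)=\mathrm{conv}\{x^\delta:\delta\text{ an } S\text{-multicut}\}+\mathbb{R}^E_{\geq 0}$.
   Formalization: Assumes ā is not the zero vector (else, e.g. for a facet x_e ≥ 0 with e in H and ω = 0, the inequality reads 0 ≥ 0 and the claim fails); if st is already an edge outside H, the new edge st is kept as a separate parallel edge. *)

theory Defs
  imports "HOL-Analysis.Analysis" "HOL-Library.Ramsey"
begin

(* A graph is given by an edge set E together with a map ends sending every edge to its set of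
   two endpoints. For a simple graph, edges are two-element sets of nodes and ends is the identity.
   The general form is used for the graph in which a subgraph is replaced by a new edge st: an
   edge st outside the subgraph then stays distinct from (and parallel to) the new one. *)

definition joined :: "('e \<Rightarrow> 'v set) \<Rightarrow> 'e set \<Rightarrow> 'v \<Rightarrow> 'v \<Rightarrow> bool" where
  "joined ends F u v \<longleftrightarrow> (u, v) \<in> {(x, y). \<exists>e\<in>F. ends e = {x, y}}\<^sup>*"

definition connected_graph :: "('e \<Rightarrow> 'v set) \<Rightarrow> 'v set \<Rightarrow> 'e set \<Rightarrow> bool" where
  "connected_graph ends V E \<longleftrightarrow> V \<noteq> {} \<and> (\<forall>u\<in>V. \<forall>v\<in>V. joined ends E u v)"

definition multicut :: "('e \<Rightarrow> 'v set) \<Rightarrow> 'e set \<Rightarrow> 'v set set \<Rightarrow> 'e set \<Rightarrow> bool" where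
  "multicut ends E S \<delta> \<longleftrightarrow>
     \<delta> \<subseteq> E \<and> (\<forall>s t. {s, t} \<in> S \<longrightarrow> \<not> joined ends (E - \<delta>) s t)"

(* An s-t-cut is a multicut for the single terminal pair {s,t}. *)
definition min_cut_weight ::
    "('e \<Rightarrow> 'v set) \<Rightarrow> 'e set \<Rightarrow> ('e \<Rightarrow> real) \<Rightarrow> 'v \<Rightarrow> 'v \<Rightarrow> real" where
  "min_cut_weight ends E w s t = Min {\<Sum>e\<in>\<delta>. w e | \<delta>. multicut ends E {{s, t}} \<delta>}"

(* The space R^E is identified with the coordinate subspace of real ^ 'e consisting of the vectors
   that vanish outside E. *)

definition incidence_vector :: "'e set \<Rightarrow> real ^ 'e::finite" where
  "incidence_vector F = (\<chi> e. if e \<in> F then 1 else 0)"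

definition nonneg_orthant :: "'e set \<Rightarrow> (real ^ 'e::finite) set" where
  "nonneg_orthant E = {y. (\<forall>e. 0 \<le> y $ e) \<and> (\<forall>e. e \<notin> E \<longrightarrow> y $ e = 0)}"

definition MultC :: "('e::finite \<Rightarrow> 'v set) \<Rightarrow> 'e set \<Rightarrow> 'v set set \<Rightarrow> (real ^ 'e) set" where
  "MultC ends E S =
     {x + y | x y. x \<in> convex hull {incidence_vector \<delta> | \<delta>. multicut ends E S \<delta>} \<and>
                   y \<in> nonneg_orthant E}"

definition facet_defining :: "'a::euclidean_space set \<Rightarrow> 'a \<Rightarrow> real \<Rightarrow> bool" where
  "facet_defining P a b \<longleftrightarrow> (\<forall>x\<in>P. a \<bullet> x \<ge> b) \<and> (P \<inter> {x. a \<bullet> x = b}) facet_of P"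

(* Replacing the edges EH of a subgraph by one new edge st: None is the new edge, and Some e is
   the old edge e. The nodes other than s and t of the subgraph are no longer incident to any
   edge; this leaves MultC unchanged, as it depends on the edges only. *)

definition replaced_ends :: "'v \<Rightarrow> 'v \<Rightarrow> 'v set option \<Rightarrow> 'v set" where
  "replaced_ends s t e = (case e of None \<Rightarrow> {s, t} | Some e' \<Rightarrow> e')"

definition replaced_edges :: "'v set set \<Rightarrow> 'v set set \<Rightarrow> 'v set option set" where
  "replaced_edges E EH = insert None (Some ` (E - EH))"

end

(* Since MultC is full-dimensional in R^E, a valid inequality a x >= b with a tight multicut and
   with a nonzero on E is facet-defining iff every equation c x = d holding on the induced face has
   c proportional to a on E. Such an equation holds on the face iff it holds at all tight multicuts
   and c_e = 0 whenever a_e = 0.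

   A multicut of G meets EH either in an s-t-cut of H or not, and the multicut property only
   depends on which of the two occurs; multicuts of the new graph record this by containing the
   edge st or not. At a tight multicut the part inside H has weight omega in the first case and 0
   in the second. An equation cbar x = d on the new face is therefore lifted to one on the old face
   by putting c_e = (cbar_st / omega) a_e on EH. It follows that c is a multiple of a on E, and
   hence that cbar is a multiple of abar. *)

theory Submission
  imports Defs
begin

section \<open>Codimension one inside a subspace, expressed by normal vectors\<close>

text \<open>The vectors of \<open>L\<close> with constant inner product on \<open>F\<close> form the
  orthogonal complement \<open>W\<close>, within \<open>L\<close>, of the direction space
  \<open>U\<close> of \<open>F\<close>. Since \<open>dim W + dim U = dim L\<close>, codimension one
  means that \<open>W\<close> is a line, and \<open>a\<close> is a nonzero vector on it.\<close>

lemma aff_dim_eq_dim_minus_one_iff: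
  fixes L F :: "'a::euclidean_space set"
  assumes L: "subspace L" and F: "F \<subseteq> L" "F \<noteq> {}"
    and a: "a \<in> L" "a \<noteq> 0" "\<And>x. x \<in> F \<Longrightarrow> a \<bullet> x = b"
  shows "aff_dim F = int (dim L) - 1 \<longleftrightarrow>
    (\<forall>c\<in>L. \<forall>d. (\<forall>x\<in>F. c \<bullet> x = d) \<longrightarrow> (\<exists>l. c = l *\<^sub>R a))"
proof -
  obtain x0 where x0: "x0 \<in> F" using F by blast
  define U where "U = span ((+) (- x0) ` F)"
  define W where "W = {y \<in> L. \<forall>x\<in>U. orthogonal x y}"
  have dimU: "aff_dim F = int (dim U)"
    unfolding U_def dim_span using x0 by (intro aff_dim_eq_dim hull_inc)
  have "U \<subseteq> L"
    unfolding U_def using F L x0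
    by (intro span_minimal) (auto intro!: subspace_diff[of L, simplified])
  then have dims: "dim W + dim U = dim L"
    unfolding W_def by (intro dim_subspace_orthogonal_to_vectors) (auto simp: L U_def)
  have W_iff: "c \<in> W \<longleftrightarrow> c \<in> L \<and> (\<exists>d. \<forall>x\<in>F. c \<bullet> x = d)" for c
  proof
    assume "c \<in> W"
    then have "c \<in> L" "\<And>x. x \<in> F \<Longrightarrow> orthogonal (- x0 + x) c"
      by (auto simp: W_def U_def span_base)
    then have "\<forall>x\<in>F. c \<bullet> x = c \<bullet> x0"
      by (auto simp: orthogonal_def inner_simps inner_commute)
    with \<open>c \<in> L\<close> show "c \<in> L \<and> (\<exists>d. \<forall>x\<in>F. c \<bullet> x = d)" by blast
  next
    assume "c \<in> L \<and> (\<exists>d. \<forall>x\<in>F. c \<bullet> x = d)"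
    then obtain d where c: "c \<in> L" "\<And>x. x \<in> F \<Longrightarrow> c \<bullet> x = d" by blast
    have "orthogonal c x" if "x \<in> U" for x
      using that unfolding U_def
      by (rule orthogonal_to_span) (auto simp: orthogonal_def inner_simps c x0)
    then show "c \<in> W" using c by (auto simp: W_def orthogonal_commute)
  qed
  have "a \<in> W" using a by (auto simp: W_iff)
  have subW: "subspace W"
    unfolding W_def using L
    by (auto simp: subspace_def orthogonal_def inner_simps)
  have "aff_dim F = int (dim L) - 1 \<longleftrightarrow> dim W = 1"
    using dims dimU by linarith
  also have "\<dots> \<longleftrightarrow> W = span {a}"
  proof
    assume "dim W = 1"
    moreover have "span {a} \<subseteq> W" using \<open>a \<in> W\<close> subW by (simp add: span_minimal)
    ultimately show "W = span {a}"
      using subspace_dim_equal[of "span {a}" W] subW a by simp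
  qed (simp add: a)
  also have "\<dots> \<longleftrightarrow> W \<subseteq> span {a}"
    using \<open>a \<in> W\<close> subW span_minimal[of "{a}" W] by auto
  also have "\<dots> \<longleftrightarrow> (\<forall>c\<in>L. \<forall>d. (\<forall>x\<in>F. c \<bullet> x = d) \<longrightarrow> (\<exists>l. c = l *\<^sub>R a))"
    unfolding subset_iff W_iff span_singleton image_iff by blast
  finally show ?thesis .
qed

section \<open>Walks in graphs\<close>

lemma joined_refl [simp]: "joined ends F u u"
  by (simp add: joined_def)

lemma joined_trans: "joined ends F u v \<Longrightarrow> joined ends F v w \<Longrightarrow> joined ends F u w"
  by (auto simp: joined_def)

lemma joined_edge: "e \<in> F \<Longrightarrow> ends e = {u, v} \<Longrightarrow> joined ends F u v"
  by (auto simp: joined_def)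

lemma joined_empty [simp]: "joined ends {} u v \<longleftrightarrow> u = v"
  by (simp add: joined_def)

lemma joined_sym:
  assumes "joined ends F u v"
  shows "joined ends F v u"
proof -
  have "sym {(x, y). \<exists>e\<in>F. ends e = {x, y}}"
    by (auto simp: sym_def insert_commute)
  from sym_rtrancl[OF this] assms show ?thesis
    by (auto simp: joined_def dest: symD)
qed

lemma joined_induct [consumes 1, case_names refl step]:
  assumes "joined ends F u v"
    and "P u"
    and "\<And>v w e. joined ends F u v \<Longrightarrow> e \<in> F \<Longrightarrow> ends e = {v, w} \<Longrightarrow> P v \<Longrightarrow> P w"
  shows "P v"
proof -
  have "(u, v) \<in> {(x, y). \<exists>e\<in>F. ends e = {x, y}}\<^sup>*"
    using assms(1) by (simp add: joined_def)
  then show ?thesis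
  proof (induction rule: rtrancl_induct)
    case (step y z)
    then show ?case using assms(3) by (auto simp: joined_def)
  qed (rule assms(2))
qed

text \<open>Carries walks over to a graph with another edge type, by replacing each edge with a
  walk.\<close>

lemma joined_simulate:
  assumes "joined ends F u v"
    and "\<And>e x y. e \<in> F \<Longrightarrow> ends e = {x, y} \<Longrightarrow> joined ends' F' x y"
  shows "joined ends' F' u v"
  using assms(1)
proof (induction rule: joined_induct)
  case (step v w e)
  then show ?case by (metis joined_trans assms(2))
qed simp

section \<open>Multicuts and the geometry of the multicut dominant\<close>

text \<open>With all edges removed a node is joined only to itself, so only a degenerate pair
  \<open>{v}\<close> could fail to be separated.\<close>

lemma multicut_all_edges:
  assumes "\<And>v. {v} \<notin> S"
  shows "multicut ends E S E"
  using assms by (auto simp: multicut_def)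

lemma inner_incidence_vector:
  fixes c :: "real ^ 'e::finite"
  shows "c \<bullet> incidence_vector \<delta> = (\<Sum>e\<in>\<delta>. c $ e)"
proof -
  have "c \<bullet> incidence_vector \<delta> = (\<Sum>e\<in>UNIV. if e \<in> \<delta> then c $ e else 0)"
    unfolding inner_vec_def incidence_vector_def by (rule sum.cong) auto
  then show ?thesis by (simp add: sum.If_cases)
qed

definition coord_subspace :: "'e set \<Rightarrow> (real ^ 'e::finite) set" where
  "coord_subspace E = {x. \<forall>e. e \<notin> E \<longrightarrow> x $ e = 0}"

lemma subspace_coord_subspace: "subspace (coord_subspace E)"
  by (auto simp: subspace_def coord_subspace_def)

lemma dim_coord_subspace: "dim (coord_subspace E :: (real ^ 'e::finite) set) = card E"
  unfolding coord_subspace_def dim_vec_eq[symmetric] by (rule dim_substandard_cart)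

lemma inner_coord_subspace_cong:
  fixes c c' x :: "real ^ 'e::finite"
  assumes "x \<in> coord_subspace E" "\<And>e. e \<in> E \<Longrightarrow> c $ e = c' $ e"
  shows "c \<bullet> x = c' \<bullet> x"
  unfolding inner_vec_def using assms
  by (intro sum.cong) (auto simp: coord_subspace_def)

lemma MultC_subset: "MultC ends E S \<subseteq> coord_subspace E"
proof -
  have "convex hull {incidence_vector \<delta> | \<delta>. multicut ends E S \<delta>} \<subseteq> coord_subspace E"
    by (rule hull_minimal)
      (auto simp: coord_subspace_def incidence_vector_def multicut_def
        intro: subspace_imp_convex subspace_coord_subspace[unfolded coord_subspace_def])
  moreover have "nonneg_orthant E \<subseteq> coord_subspace E"
    by (auto simp: nonneg_orthant_def coord_subspace_def)
  ultimately show ?thesis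
    unfolding MultC_def by (auto intro!: subspace_add subspace_coord_subspace)
qed

lemma incidence_vector_in_MultC:
  "multicut ends E S \<delta> \<Longrightarrow> incidence_vector \<delta> \<in> MultC ends E S"
  unfolding MultC_def
  by (rule CollectI, rule exI[of _ "incidence_vector \<delta>"], rule exI[of _ 0])
    (auto simp: nonneg_orthant_def intro!: hull_inc)

text \<open>These rays are the source of full dimension, of nonnegative coefficients in valid
  inequalities, and of the condition on coordinates with \<open>a $ e = 0\<close>.\<close>

lemma MultC_add_axis:
  assumes "x \<in> MultC ends E S" "e \<in> E" "r \<ge> 0"
  shows "x + axis e r \<in> MultC ends E S"
proof -
  obtain h y where "x = h + y" and h: "h \<in> convex hull {incidence_vector \<delta> | \<delta>. multicut ends E S \<delta>}"
    and y: "y \<in> nonneg_orthant E"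
    using assms(1) by (auto simp: MultC_def)
  moreover have "y + axis e r \<in> nonneg_orthant E"
    using y assms by (auto simp: nonneg_orthant_def axis_def)
  ultimately show ?thesis
    unfolding MultC_def by (auto simp: add.assoc)
qed

lemma convex_MultC: "convex (MultC ends E S)"
proof -
  have "convex (nonneg_orthant E)"
    by (auto simp: nonneg_orthant_def convex_def)
  moreover have "MultC ends E S =
    (\<Union>x\<in>convex hull {incidence_vector \<delta> | \<delta>. multicut ends E S \<delta>}. \<Union>y\<in>nonneg_orthant E. {x + y})"
    unfolding MultC_def by auto
  ultimately show ?thesis
    using convex_sums[OF convex_convex_hull] by (simp only:)
qed

text \<open>The unit steps along the edges of \<open>E\<close>, taken from one multicut vector, are
  \<open>card E\<close> independent directions; the coordinate subspace gives the matching upper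
  bound.\<close>

lemma aff_dim_MultC:
  assumes "multicut ends E S \<delta>"
  shows "aff_dim (MultC ends E S) = int (card E)"
proof -
  let ?P = "MultC ends E S" and ?x = "incidence_vector \<delta>"
  have x: "?x \<in> ?P" using assms by (rule incidence_vector_in_MultC)
  have "aff_dim ?P \<le> int (card E)"
    using aff_dim_subset[OF MultC_subset] aff_dim_subspace[OF subspace_coord_subspace]
    by (metis dim_coord_subspace)
  moreover have "card E \<le> dim ((+) (- ?x) ` ?P)"
  proof -
    have "(\<lambda>e. axis e (1::real)) ` E \<subseteq> (+) (- ?x) ` ?P"
    proof
      fix z assume "z \<in> (\<lambda>e. axis e (1::real)) ` E"
      then obtain e where "e \<in> E" "z = axis e 1" by blast
      then have "z = - ?x + (?x + axis e 1)" "?x + axis e 1 \<in> ?P"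
        using MultC_add_axis[OF x] by auto
      then show "z \<in> (+) (- ?x) ` ?P" by blast
    qed
    moreover have "independent ((\<lambda>e. axis e (1::real)) ` E)"
      by (rule independent_mono[OF independent_Basis]) (auto simp: Basis_vec_def)
    moreover have "card ((\<lambda>e. axis e (1::real)) ` E) = card E"
      by (rule card_image) (auto simp: inj_on_def axis_eq_axis)
    ultimately show ?thesis
      by (metis independent_card_le_dim)
  qed
  ultimately show ?thesis
    using aff_dim_eq_dim[OF hull_inc[OF x]] by force
qed

text \<open>For \<open>x = h + y\<close> both \<open>a \<bullet> h \<ge> b\<close> and
  \<open>a \<bullet> y \<ge> 0\<close> hold, so tightness of \<open>x\<close> forces equality in
  both; the second is a sum of nonnegative terms, which must all vanish.\<close>

lemma MultC_tight_decompose: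
  fixes a :: "real ^ 'e::finite"
  assumes valid: "\<And>\<delta>. multicut ends E S \<delta> \<Longrightarrow> b \<le> (\<Sum>e\<in>\<delta>. a $ e)"
    and nonneg: "\<And>e. e \<in> E \<Longrightarrow> 0 \<le> a $ e"
    and x: "x \<in> MultC ends E S"
  shows "b \<le> a \<bullet> x"
    and "a \<bullet> x = b \<Longrightarrow> \<exists>h y. x = h + y
      \<and> h \<in> convex hull {incidence_vector \<delta> | \<delta>. multicut ends E S \<delta> \<and> (\<Sum>e\<in>\<delta>. a $ e) = b}
      \<and> y \<in> nonneg_orthant E \<and> (\<forall>e\<in>E. a $ e * y $ e = 0)"
proof -
  let ?X = "{incidence_vector \<delta> | \<delta>. multicut ends E S \<delta>}"
  obtain h y where xhy: "x = h + y" and h: "h \<in> convex hull ?X"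
    and y: "y \<in> nonneg_orthant E"
    using x by (auto simp: MultC_def)
  have hull: "convex hull ?X \<subseteq> {z. a \<bullet> z \<ge> b}"
    by (rule hull_minimal) (auto simp: inner_incidence_vector convex_halfspace_ge valid)
  have ay: "a \<bullet> y = (\<Sum>e\<in>E. a $ e * y $ e)"
    unfolding inner_vec_def using y
    by (intro sum.mono_neutral_cong_right) (auto simp: nonneg_orthant_def)
  have term_nonneg: "0 \<le> a $ e * y $ e" if "e \<in> E" for e
    using that y nonneg by (auto simp: nonneg_orthant_def)
  have "a \<bullet> y \<ge> 0" unfolding ay by (intro sum_nonneg term_nonneg)
  moreover have "a \<bullet> h \<ge> b" using h hull by blast
  ultimately show "b \<le> a \<bullet> x" by (simp add: xhy inner_simps)
  assume "a \<bullet> x = b"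
  then have eqs: "a \<bullet> h = b" "a \<bullet> y = 0"
    using \<open>a \<bullet> y \<ge> 0\<close> \<open>a \<bullet> h \<ge> b\<close> by (auto simp: xhy inner_simps)
  have zero: "\<forall>e\<in>E. a $ e * y $ e = 0"
    using eqs(2) term_nonneg unfolding ay by (subst (asm) sum_nonneg_eq_0_iff) auto
  have "finite ?X" by (simp add: full_SetCompr_eq setcompr_eq_image)
  \<comment> \<open>A face of the hull of a finite set is the hull of some of the generators, so
    \<open>h\<close> is a convex combination of tight multicuts only.\<close>
  moreover have "(convex hull ?X \<inter> {z. a \<bullet> z = b}) face_of convex hull ?X"
    using hull by (intro face_of_Int_supporting_hyperplane_ge) auto
  ultimately obtain X' where X': "X' \<subseteq> ?X" "convex hull ?X \<inter> {z. a \<bullet> z = b} = convex hull X'"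
    by (meson face_of_convex_hull_subset finite_imp_compact)
  have "X' \<subseteq> {z. a \<bullet> z = b}" using X'(2) hull_subset[of X' convex] by blast
  then have "X' \<subseteq> {incidence_vector \<delta> | \<delta>. multicut ends E S \<delta> \<and> (\<Sum>e\<in>\<delta>. a $ e) = b}"
    using X'(1) by (fastforce simp: inner_incidence_vector)
  moreover have "h \<in> convex hull X'" using X'(2) h eqs by blast
  ultimately show "\<exists>h y. x = h + y
      \<and> h \<in> convex hull {incidence_vector \<delta> | \<delta>. multicut ends E S \<delta> \<and> (\<Sum>e\<in>\<delta>. a $ e) = b}
      \<and> y \<in> nonneg_orthant E \<and> (\<forall>e\<in>E. a $ e * y $ e = 0)"
    using xhy y zero hull_mono by blast
qed

section \<open>Facets described by multicuts alone\<close>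

text \<open>A criterion that can be compared across two graphs. A nonzero coefficient on
  \<open>E\<close> keeps the face from being the whole polyhedron; the last clause says that the
  equation of the face is unique up to scaling on \<open>E\<close>. Its condition on
  \<open>a $ e = 0\<close> comes from the rays that lie in the face.\<close>

definition combinatorial_facet ::
    "('e::finite \<Rightarrow> 'v set) \<Rightarrow> 'e set \<Rightarrow> 'v set set \<Rightarrow> real ^ 'e \<Rightarrow> real \<Rightarrow> bool" where
  "combinatorial_facet ends E S a b \<longleftrightarrow>
     (\<forall>\<delta>. multicut ends E S \<delta> \<longrightarrow> b \<le> (\<Sum>e\<in>\<delta>. a $ e)) \<and>
     (\<forall>e\<in>E. 0 \<le> a $ e) \<and>
     (\<exists>\<delta>. multicut ends E S \<delta> \<and> (\<Sum>e\<in>\<delta>. a $ e) = b) \<and>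
     (\<exists>e\<in>E. a $ e \<noteq> 0) \<and>
     (\<forall>c :: real ^ 'e. \<forall>d.
        (\<forall>\<delta>. multicut ends E S \<delta> \<longrightarrow> (\<Sum>e\<in>\<delta>. a $ e) = b \<longrightarrow> (\<Sum>e\<in>\<delta>. c $ e) = d) \<longrightarrow>
        (\<forall>e\<in>E. a $ e = 0 \<longrightarrow> c $ e = 0) \<longrightarrow>
        (\<exists>l. \<forall>e\<in>E. c $ e = l * a $ e))"

text \<open>A negative coefficient would make \<open>a \<bullet> x\<close> unbounded below along the
  corresponding ray.\<close>

lemma MultC_valid_iff:
  fixes a :: "real ^ 'e::finite"
  assumes "multicut ends E S \<delta>0"
  shows "(\<forall>x\<in>MultC ends E S. a \<bullet> x \<ge> b) \<longleftrightarrow>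
    (\<forall>\<delta>. multicut ends E S \<delta> \<longrightarrow> b \<le> (\<Sum>e\<in>\<delta>. a $ e)) \<and> (\<forall>e\<in>E. 0 \<le> a $ e)"
proof
  assume valid: "\<forall>x\<in>MultC ends E S. a \<bullet> x \<ge> b"
  have "0 \<le> a $ e" if "e \<in> E" for e
  proof (rule ccontr)
    assume neg: "\<not> 0 \<le> a $ e"
    let ?x = "incidence_vector \<delta>0 :: real ^ 'e"
    \<comment> \<open>The step length is chosen so that the value drops to exactly
      \<open>b - 1\<close>.\<close>
    let ?r = "(a \<bullet> ?x - b + 1) / - (a $ e)"
    have "a \<bullet> ?x \<ge> b"
      using valid incidence_vector_in_MultC[OF assms] by blast
    then have "?r \<ge> 0" using neg by (intro divide_nonneg_pos) auto
    then have "a \<bullet> (?x + axis e ?r) \<ge> b"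
      using valid MultC_add_axis[OF incidence_vector_in_MultC[OF assms] that] by blast
    moreover have "a \<bullet> axis e ?r = - (a \<bullet> ?x - b + 1)"
      using neg by (simp add: inner_axis)
    ultimately show False by (simp add: inner_simps)
  qed
  then show "(\<forall>\<delta>. multicut ends E S \<delta> \<longrightarrow> b \<le> (\<Sum>e\<in>\<delta>. a $ e)) \<and> (\<forall>e\<in>E. 0 \<le> a $ e)"
    using valid incidence_vector_in_MultC by (metis inner_incidence_vector)
qed (auto intro: MultC_tight_decompose)

text \<open>The face is generated by the tight multicuts and the rays along edges with
  \<open>a $ e = 0\<close>; a linear function is constant on it iff it is constant on the former and
  zero on the latter.\<close>

lemma MultC_tight_constant_iff:
  fixes a c :: "real ^ 'e::finite"
  assumes valid: "\<And>\<delta>. multicut ends E S \<delta> \<Longrightarrow> b \<le> (\<Sum>e\<in>\<delta>. a $ e)"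
    and nonneg: "\<And>e. e \<in> E \<Longrightarrow> 0 \<le> a $ e"
    and tight: "multicut ends E S \<delta>0" "(\<Sum>e\<in>\<delta>0. a $ e) = b"
  shows "(\<forall>x\<in>MultC ends E S \<inter> {x. a \<bullet> x = b}. c \<bullet> x = d) \<longleftrightarrow>
    (\<forall>\<delta>. multicut ends E S \<delta> \<longrightarrow> (\<Sum>e\<in>\<delta>. a $ e) = b \<longrightarrow> (\<Sum>e\<in>\<delta>. c $ e) = d) \<and>
    (\<forall>e\<in>E. a $ e = 0 \<longrightarrow> c $ e = 0)"
    (is "?constant \<longleftrightarrow> ?cuts \<and> ?rays")
proof
  assume const: ?constant
  have cuts: ?cuts
    using const incidence_vector_in_MultC[of ends E S] by (auto simp flip: inner_incidence_vector)
  have "c $ e = 0" if "e \<in> E" "a $ e = 0" for e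
  proof -
    let ?x = "incidence_vector \<delta>0 :: real ^ 'e"
    have "?x + axis e 1 \<in> MultC ends E S"
      by (intro MultC_add_axis incidence_vector_in_MultC tight(1) that(1)) simp
    moreover have "a \<bullet> (?x + axis e 1) = b"
      using that tight by (simp add: inner_simps inner_axis inner_incidence_vector)
    ultimately have "c \<bullet> (?x + axis e 1) = d" using const by blast
    moreover have "c \<bullet> ?x = d" using cuts tight by (simp add: inner_incidence_vector)
    ultimately show ?thesis by (simp add: inner_simps inner_axis)
  qed
  then show "?cuts \<and> ?rays" using cuts by blast
next
  assume c: "?cuts \<and> ?rays"
  show ?constant
  proof
    fix x assume "x \<in> MultC ends E S \<inter> {x. a \<bullet> x = b}"
    then obtain h y where xhy: "x = h + y"
      and h: "h \<in> convex hull {incidence_vector \<delta> | \<delta>. multicut ends E S \<delta> \<and> (\<Sum>e\<in>\<delta>. a $ e) = b}"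
      and y: "y \<in> nonneg_orthant E" "\<forall>e\<in>E. a $ e * y $ e = 0"
      using MultC_tight_decompose(2)[OF valid nonneg, where x = x] by blast
    have "convex hull {incidence_vector \<delta> | \<delta>. multicut ends E S \<delta> \<and> (\<Sum>e\<in>\<delta>. a $ e) = b}
        \<subseteq> {z. c \<bullet> z = d}"
      using c by (intro hull_minimal convex_hyperplane) (auto simp: inner_incidence_vector)
    moreover have "c $ e * y $ e = 0" for e
      using y c by (cases "e \<in> E") (auto simp: nonneg_orthant_def)
    then have "c \<bullet> y = 0" unfolding inner_vec_def inner_real_def by (simp only: sum.neutral_const)
    ultimately show "c \<bullet> x = d" using h by (auto simp: xhy inner_simps)
  qed
qed

lemma facet_defining_MultC_iff:
  fixes a :: "real ^ 'e::finite"
  assumes S: "\<And>v. {v} \<notin> S"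
  shows "facet_defining (MultC ends E S) a b \<longleftrightarrow> combinatorial_facet ends E S a b"
proof -
  let ?P = "MultC ends E S" and ?L = "coord_subspace E"
  let ?F = "?P \<inter> {x. a \<bullet> x = b}"
  have E: "multicut ends E S E" using S by (rule multicut_all_edges)
  \<comment> \<open>The vectors \<open>a\<close> and \<open>c\<close> may be nonzero off
    \<open>E\<close>. Projecting them to the coordinate subspace changes no inner product with
    points of \<open>MultC\<close> and makes the dimension criterion applicable.\<close>
  define p :: "real ^ 'e \<Rightarrow> real ^ 'e" where "p c = (\<chi> e. if e \<in> E then c $ e else 0)" for c
  have p_L: "p c \<in> ?L" for c by (simp add: p_def coord_subspace_def)
  have p_inner: "p c \<bullet> x = c \<bullet> x" if "x \<in> ?P" for c x
    using that MultC_subset by (intro inner_coord_subspace_cong) (auto simp: p_def)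
  \<comment> \<open>A valid inequality always cuts out a face, so only nonemptiness and dimension
    remain.\<close>
  have "facet_defining ?P a b \<longleftrightarrow>
      (\<forall>x\<in>?P. a \<bullet> x \<ge> b) \<and> ?F \<noteq> {} \<and> aff_dim ?F = int (card E) - 1"
    unfolding facet_defining_def facet_of_def aff_dim_MultC[OF E]
    using face_of_Int_supporting_hyperplane_ge[OF convex_MultC] by blast
  also have "\<dots> \<longleftrightarrow> (\<forall>x\<in>?P. a \<bullet> x \<ge> b) \<and> ?F \<noteq> {} \<and> p a \<noteq> 0 \<and>
      (\<forall>c d. (\<forall>x\<in>?F. c \<bullet> x = d) \<longrightarrow> (\<exists>l. p c = l *\<^sub>R p a))"
  proof (intro conj_cong refl)
    assume "?F \<noteq> {}"
    show "aff_dim ?F = int (card E) - 1 \<longleftrightarrow> p a \<noteq> 0 \<and>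
      (\<forall>c d. (\<forall>x\<in>?F. c \<bullet> x = d) \<longrightarrow> (\<exists>l. p c = l *\<^sub>R p a))"
    proof (cases "p a = 0")
      \<comment> \<open>Here a point of the face shows \<open>b = 0\<close>, so the face is the
        whole polyhedron and both sides are false.\<close>
      case True
      then have "a \<bullet> x = 0" if "x \<in> ?P" for x using p_inner[OF that, of a] by simp
      with \<open>?F \<noteq> {}\<close> have "?F = ?P" by auto
      then show ?thesis using True aff_dim_MultC[OF E] by simp
    next
      case False
      have "aff_dim ?F = int (dim ?L) - 1 \<longleftrightarrow>
        (\<forall>c\<in>?L. \<forall>d. (\<forall>x\<in>?F. c \<bullet> x = d) \<longrightarrow> (\<exists>l. c = l *\<^sub>R p a))"
        using MultC_subset \<open>?F \<noteq> {}\<close> False p_L p_inner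
        by (intro aff_dim_eq_dim_minus_one_iff[where b = b] subspace_coord_subspace) auto
      also have "\<dots> \<longleftrightarrow> (\<forall>c d. (\<forall>x\<in>?F. c \<bullet> x = d) \<longrightarrow> (\<exists>l. p c = l *\<^sub>R p a))"
      proof -
        have p_id: "p c = c" if "c \<in> ?L" for c
          using that by (auto simp: p_def coord_subspace_def vec_eq_iff)
        have p_const: "\<forall>x\<in>?F. p c \<bullet> x = d" if "\<forall>x\<in>?F. c \<bullet> x = d" for c d
          using that p_inner by auto
        show ?thesis
        proof (intro iffI allI ballI impI)
          fix c d
          assume *: "\<forall>c\<in>?L. \<forall>d. (\<forall>x\<in>?F. c \<bullet> x = d) \<longrightarrow> (\<exists>l. c = l *\<^sub>R p a)"
            and c: "\<forall>x\<in>?F. c \<bullet> x = d"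
          show "\<exists>l. p c = l *\<^sub>R p a"
            by (rule mp[OF spec[OF bspec[OF * p_L]] p_const[OF c]])
        next
          fix c d
          assume "\<forall>c d. (\<forall>x\<in>?F. c \<bullet> x = d) \<longrightarrow> (\<exists>l. p c = l *\<^sub>R p a)" "c \<in> ?L"
            and "\<forall>x\<in>?F. c \<bullet> x = d"
          then have "\<exists>l. p c = l *\<^sub>R p a" by blast
          then show "\<exists>l. c = l *\<^sub>R p a" by (simp only: p_id[OF \<open>c \<in> ?L\<close>])
        qed
      qed
      finally show ?thesis using False by (simp add: dim_coord_subspace)
    qed
  qed
  also have "\<dots> \<longleftrightarrow> combinatorial_facet ends E S a b"
  proof -
    have multiple: "p c = l *\<^sub>R p a \<longleftrightarrow> (\<forall>e\<in>E. c $ e = l * a $ e)" for c l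
      by (auto simp: p_def vec_eq_iff)
    have zero: "p a \<noteq> 0 \<longleftrightarrow> (\<exists>e\<in>E. a $ e \<noteq> 0)"
      by (auto simp: p_def vec_eq_iff)
    show ?thesis
    proof (cases "\<forall>x\<in>?P. a \<bullet> x \<ge> b")
      case True
      then have valid: "\<And>\<delta>. multicut ends E S \<delta> \<Longrightarrow> b \<le> (\<Sum>e\<in>\<delta>. a $ e)"
        and nonneg: "\<And>e. e \<in> E \<Longrightarrow> 0 \<le> a $ e"
        using MultC_valid_iff[OF E] by blast+
      have nonempty: "?F \<noteq> {} \<longleftrightarrow> (\<exists>\<delta>. multicut ends E S \<delta> \<and> (\<Sum>e\<in>\<delta>. a $ e) = b)"
      proof
        assume "?F \<noteq> {}"
        then have "convex hull {incidence_vector \<delta> | \<delta>. multicut ends E S \<delta> \<and> (\<Sum>e\<in>\<delta>. a $ e) = b} \<noteq> {}"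
          using MultC_tight_decompose(2)[OF valid nonneg] by fast
        then show "\<exists>\<delta>. multicut ends E S \<delta> \<and> (\<Sum>e\<in>\<delta>. a $ e) = b" by auto
      next
        assume "\<exists>\<delta>. multicut ends E S \<delta> \<and> (\<Sum>e\<in>\<delta>. a $ e) = b"
        then show "?F \<noteq> {}"
          using incidence_vector_in_MultC by (fastforce simp: inner_incidence_vector)
      qed
      show ?thesis
      \<comment> \<open>The description of functions constant on the face starts from a tight
        multicut; if there is none, both sides are false.\<close>
      proof (cases "\<exists>\<delta>. multicut ends E S \<delta> \<and> (\<Sum>e\<in>\<delta>. a $ e) = b")
        case tight: True
        then obtain \<delta>0 where \<delta>0: "multicut ends E S \<delta>0" "(\<Sum>e\<in>\<delta>0. a $ e) = b" by blast
        have const: "(\<forall>x\<in>?F. c \<bullet> x = d) \<longleftrightarrow>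
            (\<forall>\<delta>. multicut ends E S \<delta> \<longrightarrow> (\<Sum>e\<in>\<delta>. a $ e) = b \<longrightarrow> (\<Sum>e\<in>\<delta>. c $ e) = d) \<and>
            (\<forall>e\<in>E. a $ e = 0 \<longrightarrow> c $ e = 0)" for c d
          by (intro MultC_tight_constant_iff[OF _ _ \<delta>0] valid nonneg)
        show ?thesis
          unfolding combinatorial_facet_def nonempty zero multiple const MultC_valid_iff[OF E]
          by (simp only: conj_assoc imp_conjL)
      next
        case False
        then show ?thesis unfolding nonempty combinatorial_facet_def by blast
      qed
    next
      case False
      then show ?thesis
        unfolding combinatorial_facet_def MultC_valid_iff[OF E] by blast
    qed
  qed
  finally show ?thesis .
qed

section \<open>Replacing a subgraph attached at two nodes by an edge\<close>

locale edge_replacement =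
  fixes VH :: "'v::finite set" and E EH S :: "'v set set" and s t :: 'v
  assumes no_singleton_terminals: "{v} \<notin> S"
    and H: "EH \<subseteq> E" "EH \<subseteq> nsets VH 2" "connected_graph (\<lambda>e. e) VH EH"
    and st: "s \<in> VH" "t \<in> VH" "s \<noteq> t"
    and attached: "\<forall>e\<in>E - EH. e \<inter> (VH - {s, t}) = {}"
    and nonterminals: "(VH - {s, t}) \<inter> \<Union>S = {}"
begin

abbreviation separating :: "'v set set \<Rightarrow> bool" where
  "separating C \<equiv> multicut (\<lambda>e. e) EH {{s, t}} C"

text \<open>The trace in the new graph of the edge set \<open>D \<union> C\<close>, with
  \<open>D\<close> outside and \<open>C\<close> inside \<open>EH\<close>. Of \<open>C\<close> it
  remembers only whether \<open>s\<close> and \<open>t\<close> are separated.\<close>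

definition lift_cut :: "'v set set \<Rightarrow> 'v set set \<Rightarrow> 'v set option set" where
  "lift_cut D C = Some ` D \<union> (if separating C then {None} else {})"

lemma separating_iff: "C \<subseteq> EH \<Longrightarrow> separating C \<longleftrightarrow> \<not> joined (\<lambda>e. e) (EH - C) s t"
  by (auto simp: multicut_def doubleton_eq_iff intro: joined_sym)

text \<open>Walks enter and leave \<open>H\<close> only through \<open>s\<close> and
  \<open>t\<close>. Between nodes outside its interior, \<open>H\<close> therefore acts as an edge
  \<open>st\<close> that survives exactly when \<open>EH - C\<close> still joins \<open>s\<close>
  and \<open>t\<close>.\<close>

lemma joined_replaced_iff:
  assumes D: "D \<subseteq> E - EH" and C: "C \<subseteq> EH"
    and u: "u \<notin> VH - {s, t}" and v: "v \<notin> VH - {s, t}"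
  shows "joined (replaced_ends s t) (replaced_edges E EH - lift_cut D C) u v \<longleftrightarrow>
    joined (\<lambda>e. e) (E - (D \<union> C)) u v"
    (is "joined ?ends ?R u v \<longleftrightarrow> _")
proof
  assume "joined ?ends ?R u v"
  then show "joined (\<lambda>e. e) (E - (D \<union> C)) u v"
  proof (rule joined_simulate)
    fix e x y assume e: "e \<in> ?R" "?ends e = {x, y}"
    show "joined (\<lambda>e. e) (E - (D \<union> C)) x y"
    proof (cases e)
      case None
      then have "\<not> separating C" using e by (auto simp: lift_cut_def split: if_splits)
      then have "joined (\<lambda>e. e) (EH - C) s t" using separating_iff C by blast
      then have "joined (\<lambda>e. e) (E - (D \<union> C)) s t"
        by (rule joined_simulate) (use H(1) D in \<open>auto intro: joined_edge\<close>)
      moreover have "x = s \<and> y = t \<or> x = t \<and> y = s"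
        using e None by (auto simp: replaced_ends_def doubleton_eq_iff)
      ultimately show ?thesis by (auto intro: joined_sym)
    next
      case (Some e')
      then show ?thesis
        using e C by (intro joined_edge[of e'])
          (auto simp: replaced_edges_def replaced_ends_def lift_cut_def)
    qed
  qed
next
  \<comment> \<open>Invariant along a walk of the old graph: the new graph reaches a node
    \<open>p\<close> outside the interior of \<open>H\<close>, and the current node \<open>w\<close>
    is \<open>p\<close> or is reached from \<open>p\<close>, then \<open>s\<close> or
    \<open>t\<close>, within \<open>EH - C\<close>.\<close>
  let ?inv = "\<lambda>w. \<exists>p. joined ?ends ?R u p \<and> p \<notin> VH - {s, t} \<and>
      (p = w \<or> p \<in> {s, t} \<and> w \<in> VH \<and> joined (\<lambda>e. e) (EH - C) p w)"
  \<comment> \<open>If \<open>w\<close> differs from \<open>p\<close>, the two are \<open>s\<close>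
    and \<open>t\<close> in some order and are joined within \<open>EH - C\<close>; so the new edge
    has survived and leads from \<open>p\<close> to \<open>w\<close>.\<close>
  have outside: "joined ?ends ?R u w" if inv: "?inv w" and w: "w \<notin> VH - {s, t}" for w
  proof -
    obtain p where p: "joined ?ends ?R u p"
      "p = w \<or> p \<in> {s, t} \<and> w \<in> VH \<and> joined (\<lambda>e. e) (EH - C) p w"
      using inv by blast
    have "joined ?ends ?R p w"
    proof (cases "p = w")
      case False
      then have pw: "p = s \<and> w = t \<or> p = t \<and> w = s" "joined (\<lambda>e. e) (EH - C) p w"
        using p(2) w by auto
      then have "joined (\<lambda>e. e) (EH - C) s t" by (auto intro: joined_sym)
      then have "\<not> separating C" using C separating_iff by blast
      then have "None \<in> ?R" by (auto simp: replaced_edges_def lift_cut_def)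
      then show ?thesis
        using pw(1) by (intro joined_edge) (auto simp: replaced_ends_def)
    qed simp
    then show ?thesis using p(1) joined_trans by metis
  qed
  assume "joined (\<lambda>e. e) (E - (D \<union> C)) u v"
  then have "?inv v"
  proof (induction rule: joined_induct)
    case refl
    show ?case using u by (intro exI[of _ u]) simp
  next
    case (step x y e)
    show ?case
    proof (cases "e \<in> EH")
      case True
      then have xy: "x \<in> VH" "y \<in> VH" using step(3) H(2) by (auto simp: nsets_def)
      have "joined (\<lambda>e. e) (EH - C) x y"
        using True step(2,3) by (intro joined_edge) auto
      \<comment> \<open>The same \<open>p\<close> still serves: if \<open>p = x\<close>, then
        \<open>x\<close> lies in \<open>VH\<close> but not in its interior, hence is
        \<open>s\<close> or \<open>t\<close>.\<close>
      then show ?thesis using step(4) xy by (metis DiffI insertCI joined_trans)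
    next
      case False
      then have "{x, y} \<inter> (VH - {s, t}) = {}"
        using attached step(2,3) by auto
      then have xy: "x \<notin> VH - {s, t}" "y \<notin> VH - {s, t}" by auto
      have "joined ?ends ?R x y"
        using False step(2,3)
        by (intro joined_edge[of "Some e"])
          (auto simp: replaced_edges_def replaced_ends_def lift_cut_def)
      then show ?thesis using outside[OF step(4) xy(1)] xy(2) joined_trans by metis
    qed
  qed
  then show "joined ?ends ?R u v" using v by (rule outside)
qed

text \<open>Terminals avoid the interior of \<open>H\<close>, so the comparison of walks applies to
  every pair in \<open>S\<close>.\<close>

lemma multicut_lift_cut_iff:
  assumes D: "D \<subseteq> E - EH" and C: "C \<subseteq> EH"
  shows "multicut (replaced_ends s t) (replaced_edges E EH) S (lift_cut D C) \<longleftrightarrow>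
    multicut (\<lambda>e. e) E S (D \<union> C)"
proof -
  have "lift_cut D C \<subseteq> replaced_edges E EH"
    using D by (auto simp: lift_cut_def replaced_edges_def)
  moreover have "D \<union> C \<subseteq> E" using D C H by auto
  moreover have "x \<notin> VH - {s, t} \<and> y \<notin> VH - {s, t}" if "{x, y} \<in> S" for x y
    using nonterminals that by blast
  ultimately show ?thesis
    using joined_replaced_iff[OF D C] by (auto simp: multicut_def)
qed

lemma not_separating_empty: "\<not> separating {}"
  using H(3) st by (auto simp: separating_iff connected_graph_def)

lemma separating_all: "separating EH"
  using st by (simp add: separating_iff)

lemma sum_lift_cut:
  fixes w :: "'v set option \<Rightarrow> real"
  shows "(\<Sum>e\<in>lift_cut D C. w e) = (\<Sum>e\<in>D. w (Some e)) + (if separating C then w None else 0)"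
proof -
  have "(\<Sum>e\<in>Some ` D. w e) = (\<Sum>e\<in>D. w (Some e))"
    by (simp add: sum.reindex)
  then show ?thesis by (auto simp: lift_cut_def sum.insert_if)
qed

lemma min_cut_weight_attained:
  obtains C where "separating C" "(\<Sum>e\<in>C. w e) = min_cut_weight (\<lambda>e. e) EH w s t"
proof -
  let ?W = "{\<Sum>e\<in>\<delta>. w e | \<delta>. separating \<delta>}"
  have "Min ?W \<in> ?W"
    using separating_all by (intro Min_in) (auto simp: setcompr_eq_image)
  then obtain C where "Min ?W = (\<Sum>e\<in>C. w e)" "separating C" by auto
  then show thesis using that[of C] by (simp add: min_cut_weight_def)
qed

lemma min_cut_weight_le:
  "separating C \<Longrightarrow> min_cut_weight (\<lambda>e. e) EH w s t \<le> (\<Sum>e\<in>C. w e)"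
  unfolding min_cut_weight_def by (intro Min_le) (auto simp: setcompr_eq_image)

section \<open>Transfer of the facet criterion to the new graph\<close>

text \<open>Validity is pulled back along cheapest representatives inside \<open>H\<close>, while
  tight multicuts are pushed forward by \<open>lift_cut\<close>. The assumption
  \<open>nontrivial\<close> excludes degenerate cases: if \<open>H\<close> is a path
  \<open>s\<close>-\<open>u\<close>-\<open>t\<close>, \<open>b = 0\<close> and \<open>a\<close> is
  the unit vector of \<open>su\<close>, then \<open>\<omega> = 0\<close> and \<open>abar\<close>
  vanishes on all edges.\<close>

lemma facet_replacement:
  fixes a :: "real ^ 'v set" and abar :: "real ^ 'v set option"
  assumes facet: "combinatorial_facet (\<lambda>e. e) E S a b"
    and \<omega>: "\<omega> = min_cut_weight (\<lambda>e. e) EH (\<lambda>e. a $ e) s t"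
    and abar_old: "\<forall>e\<in>E - EH. abar $ Some e = a $ e"
    and abar_new: "abar $ None = \<omega>"
    and nontrivial: "\<exists>e\<in>replaced_edges E EH. abar $ e \<noteq> 0"
  shows "combinatorial_facet (replaced_ends s t) (replaced_edges E EH) S abar b"
proof -
  note facet' = facet[unfolded combinatorial_facet_def]
  let ?cut = "multicut (\<lambda>e. e) E S"
  let ?cut' = "multicut (replaced_ends s t) (replaced_edges E EH) S"
  have valid: "b \<le> (\<Sum>e\<in>\<delta>. a $ e)" if "?cut \<delta>" for \<delta> using facet' that by blast
  have nonneg: "0 \<le> a $ e" if "e \<in> E" for e using facet' that by blast
  obtain C0 where C0: "separating C0" "(\<Sum>e\<in>C0. a $ e) = \<omega>"
    using min_cut_weight_attained[of "\<lambda>e. a $ e"] \<omega> by metis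
  have C0_sub: "C0 \<subseteq> EH" using C0 by (simp add: multicut_def)
  have min: "\<omega> \<le> (\<Sum>e\<in>C. a $ e)" if "separating C" for C
    using min_cut_weight_le[OF that] \<omega> by simp
  have \<omega>_nonneg: "0 \<le> \<omega>"
    using C0_sub H nonneg by (auto simp flip: C0(2) intro!: sum_nonneg)
  have sum_abar: "(\<Sum>e\<in>lift_cut D C. abar $ e) = (\<Sum>e\<in>D. a $ e) + (if separating C then \<omega> else 0)"
    if "D \<subseteq> E - EH" for D C
  proof -
    have "(\<Sum>e\<in>D. abar $ Some e) = (\<Sum>e\<in>D. a $ e)"
      using that abar_old by (intro sum.cong) auto
    then show ?thesis using abar_new by (simp add: sum_lift_cut)
  qed
  have sum_union: "(\<Sum>e\<in>D \<union> C. w e) = (\<Sum>e\<in>D. w e) + (\<Sum>e\<in>C. w e)"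
    if "D \<subseteq> E - EH" "C \<subseteq> EH" for D C and w :: "'v set \<Rightarrow> real"
    using that by (intro sum.union_disjoint) auto
  \<comment> \<open>A multicut of the new graph is represented by the minimum cut \<open>C0\<close>
    inside \<open>H\<close> if it contains the new edge, and by the empty set otherwise. The weights
    under \<open>a\<close> and \<open>abar\<close> then agree.\<close>
  have representative: "\<exists>D C. \<delta> = lift_cut D C \<and> D \<subseteq> E - EH \<and> C \<subseteq> EH \<and>
      (\<Sum>e\<in>C. a $ e) = (if separating C then \<omega> else 0)" if "?cut' \<delta>" for \<delta>
  proof -
    let ?D = "{e. Some e \<in> \<delta>}" and ?C = "if None \<in> \<delta> then C0 else {}"
    have "\<delta> = lift_cut ?D ?C"
      using C0 not_separating_empty
      by (auto simp: lift_cut_def image_iff) (metis not_None_eq)+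
    moreover have "?D \<subseteq> E - EH"
      using that by (auto simp: multicut_def replaced_edges_def)
    ultimately show ?thesis
      using C0 C0_sub not_separating_empty
      by (intro exI[of _ ?D] exI[of _ ?C]) auto
  qed
  have valid': "b \<le> (\<Sum>e\<in>\<delta>. abar $ e)" if "?cut' \<delta>" for \<delta>
  proof -
    obtain D C where DC: "\<delta> = lift_cut D C" "D \<subseteq> E - EH" "C \<subseteq> EH"
      "(\<Sum>e\<in>C. a $ e) = (if separating C then \<omega> else 0)"
      using representative[OF \<open>?cut' \<delta>\<close>] by blast
    then have "?cut (D \<union> C)" using that by (simp add: multicut_lift_cut_iff)
    then have "b \<le> (\<Sum>e\<in>D \<union> C. a $ e)" by (rule valid)
    then show ?thesis using DC by (simp only: sum_union sum_abar)
  qed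
  have nonneg': "0 \<le> abar $ e" if "e \<in> replaced_edges E EH" for e
    using that nonneg abar_old abar_new \<omega>_nonneg by (auto simp: replaced_edges_def)
  \<comment> \<open>A heavier inside part would make the lifted multicut violate
    \<open>valid'\<close>; a lighter one contradicts minimality of \<open>\<omega>\<close> or
    nonnegativity of \<open>a\<close>.\<close>
  have tight_inside: "(\<Sum>e\<in>C. a $ e) = (if separating C then \<omega> else 0)"
    if D: "D \<subseteq> E - EH" and C: "C \<subseteq> EH"
      and tight: "?cut (D \<union> C)" "(\<Sum>e\<in>D \<union> C. a $ e) = b" for D C
  proof (rule antisym)
    have "?cut' (lift_cut D C)" using tight D C by (simp add: multicut_lift_cut_iff)
    then have "b \<le> (\<Sum>e\<in>lift_cut D C. abar $ e)" by (rule valid')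
    then show "(\<Sum>e\<in>C. a $ e) \<le> (if separating C then \<omega> else 0)"
      using tight D C by (simp add: sum_abar sum_union)
    have "0 \<le> (\<Sum>e\<in>C. a $ e)" using C H nonneg by (intro sum_nonneg) auto
    then show "(if separating C then \<omega> else 0) \<le> (\<Sum>e\<in>C. a $ e)" using min by simp
  qed
  have lift_tight: "?cut' (lift_cut D C) \<and> (\<Sum>e\<in>lift_cut D C. abar $ e) = b"
    if "D \<subseteq> E - EH" "C \<subseteq> EH" "?cut (D \<union> C)" "(\<Sum>e\<in>D \<union> C. a $ e) = b" for D C
    using that tight_inside[OF that] by (simp add: multicut_lift_cut_iff sum_abar sum_union)
  have split: "\<delta> = (\<delta> - EH) \<union> (\<delta> \<inter> EH) \<and> \<delta> - EH \<subseteq> E - EH" if "?cut \<delta>" for \<delta>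
    using that by (auto simp: multicut_def)
  have tight': "\<exists>\<delta>. ?cut' \<delta> \<and> (\<Sum>e\<in>\<delta>. abar $ e) = b"
  proof -
    obtain \<delta> where "?cut \<delta>" "(\<Sum>e\<in>\<delta>. a $ e) = b" using facet' by blast
    then show ?thesis using lift_tight[of "\<delta> - EH" "\<delta> \<inter> EH"] split[of \<delta>] by auto
  qed
  have unique: "\<exists>l. \<forall>e\<in>replaced_edges E EH. cbar $ e = l * abar $ e"
    if cuts: "\<And>\<delta>. ?cut' \<delta> \<Longrightarrow> (\<Sum>e\<in>\<delta>. abar $ e) = b \<Longrightarrow> (\<Sum>e\<in>\<delta>. cbar $ e) = d"
      and rays: "\<And>e. e \<in> replaced_edges E EH \<Longrightarrow> abar $ e = 0 \<Longrightarrow> cbar $ e = 0"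
    for cbar :: "real ^ 'v set option" and d
  proof -
    \<comment> \<open>If \<open>\<omega> = 0\<close> then \<open>k = 0\<close> by division by zero, which is right because then \<open>cbar $ None = 0\<close>.\<close>
    define k where "k = cbar $ None / \<omega>"
    have k: "k * \<omega> = cbar $ None"
      using rays[of None] abar_new by (auto simp: k_def replaced_edges_def)
    define c :: "real ^ 'v set" where "c = (\<chi> e. if e \<in> EH then k * a $ e else cbar $ Some e)"
    have "(\<Sum>e\<in>\<delta>. c $ e) = d" if \<delta>: "?cut \<delta>" "(\<Sum>e\<in>\<delta>. a $ e) = b" for \<delta>
    proof -
      let ?D = "\<delta> - EH" and ?C = "\<delta> \<inter> EH"
      have DC: "?D \<subseteq> E - EH" "?C \<subseteq> EH" "?cut (?D \<union> ?C)" "(\<Sum>e\<in>?D \<union> ?C. a $ e) = b"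
        using split[OF \<delta>(1)] \<delta> by auto
      \<comment> \<open>The inside part weighs \<open>\<omega>\<close> or 0 under \<open>a\<close>,
        hence \<open>cbar $ None\<close> or 0 under \<open>c\<close>, which is the contribution of
        the new edge to the lifted multicut under \<open>cbar\<close>.\<close>
      have "(\<Sum>e\<in>?C. c $ e) = k * (\<Sum>e\<in>?C. a $ e)"
        unfolding sum_distrib_left by (intro sum.cong) (auto simp: c_def)
      moreover have "(\<Sum>e\<in>?D. c $ e) = (\<Sum>e\<in>?D. cbar $ Some e)"
        by (intro sum.cong) (auto simp: c_def)
      moreover have "(\<Sum>e\<in>?C. a $ e) = (if separating ?C then \<omega> else 0)"
        by (rule tight_inside[OF DC])
      ultimately have "(\<Sum>e\<in>?D \<union> ?C. c $ e) = (\<Sum>e\<in>lift_cut ?D ?C. cbar $ e)"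
        unfolding sum_union[OF DC(1,2)] sum_lift_cut by (simp add: k)
      also have "\<dots> = d" using lift_tight[OF DC] cuts by blast
      finally show ?thesis using split[OF \<delta>(1)] by simp
    qed
    moreover have "c $ e = 0" if "e \<in> E" "a $ e = 0" for e
      using that rays[of "Some e"] abar_old by (auto simp: c_def replaced_edges_def)
    ultimately obtain l where l: "\<And>e. e \<in> E \<Longrightarrow> c $ e = l * a $ e"
      using facet' by metis
    have "cbar $ None = l * \<omega>"
    proof (cases "\<omega> = 0")
      case False
      \<comment> \<open>As \<open>\<omega>\<close> is the weight of \<open>C0\<close>, some edge of
        \<open>C0\<close> has a nonzero coefficient; comparing both expressions for \<open>c\<close>
        there gives \<open>k = l\<close>. For \<open>\<omega> = 0\<close> both sides of the claim
        are zero.\<close>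
      then obtain e where e: "e \<in> C0" "a $ e \<noteq> 0"
        using C0(2) by (metis sum.neutral)
      then have "k * a $ e = l * a $ e"
        using l[of e] C0_sub H(1) by (simp add: c_def subset_iff)
      then show ?thesis using k e by simp
    qed (use k in simp)
    moreover have "cbar $ Some e = l * abar $ Some e" if "e \<in> E - EH" for e
      using l[of e] that abar_old by (auto simp: c_def)
    ultimately show ?thesis
      using abar_new by (intro exI[of _ l]) (auto simp: replaced_edges_def)
  qed
  show ?thesis
    unfolding combinatorial_facet_def
    using valid' nonneg' tight' nontrivial unique by blast
qed

end

theorem theorem4p5:
  fixes V VH :: "'v::finite set" and E EH S :: "'v set set" and s t :: 'v
    and a :: "real ^ 'v set" and abar :: "real ^ 'v set option" and b \<omega> :: real
  assumes G: "E \<subseteq> nsets V 2" and S: "S \<subseteq> nsets V 2"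
    and H: "VH \<subseteq> V" "EH \<subseteq> E" "EH \<subseteq> nsets VH 2" "connected_graph (\<lambda>e. e) VH EH"
    and st: "s \<in> VH" "t \<in> VH" "s \<noteq> t"
    and attached: "\<forall>e\<in>E - EH. e \<inter> (VH - {s, t}) = {}"
    and nonterminals: "(VH - {s, t}) \<inter> \<Union>S = {}"
    and facet: "facet_defining (MultC (\<lambda>e. e) E S) a b"
    and \<omega>: "\<omega> = min_cut_weight (\<lambda>e. e) EH (\<lambda>e. a $ e) s t"
    and abar_old: "\<forall>e\<in>E - EH. abar $ Some e = a $ e"
    and abar_new: "abar $ None = \<omega>"
    and nontrivial: "\<exists>e\<in>replaced_edges E EH. abar $ e \<noteq> 0"
  shows "facet_defining (MultC (replaced_ends s t) (replaced_edges E EH) S) abar b"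
proof -
  \<comment> \<open>Members of \<open>S\<close> have two elements, which rules out degenerate
    pairs.\<close>
  interpret edge_replacement VH E EH S s t
    using S H st attached nonterminals by unfold_locales (auto simp: nsets_def)
  have "combinatorial_facet (\<lambda>e. e) E S a b"
    using facet facet_defining_MultC_iff[OF no_singleton_terminals] by blast
  then have "combinatorial_facet (replaced_ends s t) (replaced_edges E EH) S abar b"
    using \<omega> abar_old abar_new nontrivial by (rule facet_replacement)
  then show ?thesis
    using facet_defining_MultC_iff[OF no_singleton_terminals] by blast
qed

end
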